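(* Fix integers $s,m\ge1$. Write $E_r:=L_{2r+2}^{(s)}(m)$ for $r\ge0$ and $O_r:=L_{2r+1}^{(s)}(m)$ for $r\ge1$. Then the even-dimensional sequence satisfies $$E_r=\sum_{j=1}^{s}(-1)^{j+1}a_j^{(s,m)}E_{r-j}\qquad\text{for } r\ge s,$$ and the odd-dimensional sequence satisfies $$O_r=\sum_{j=1}^{s}(-1)^{j+1}a_j^{(s,m)}O_{r-j}\qquad\text{for } r\ge s+1.$$ Equivalently, if one sets $\widetilde O_0:=(s+1)m+1$ and $\widetilde O_r:=O_r$ for $r\ge1$, then the same recurrence holds for $\widetilde O_r$ for all $r\ge s+1$.
   Context: For integers $d\ge2$ and $s\ge1$ let $$\mathcal P_d^{(s)}=\{x=(x_1,\dots,x_d)\in\mathbb R_{\ge0}^d:\ x_i+x_{i+1}\le s+\delta_i,\ 1\le i\le d-1\},$$ where $\delta_i=0$ for $i$ odd and $\delta_i=1$ for $i$ even, and let $L_d^{(s)}(m):=\#(m\mathcal P_d^{(s)}\cap\mathbb Z^d)$. For $0\le j\le s$, $$a_j^{(s,m)}:=\binom{(s+1-j)m+j+1}{2j},$$ where $\binom{n}{k}=0$ for integers $0\le n<k$. *)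

theory Defs
  imports Complex_Main
begin

text \<open>
  Since the dimension d varies within a single recurrence, a point of real d-space is represented
  as a function on the naturals that vanishes outside the index set {1..d}.
\<close>

definition real_space :: "nat \<Rightarrow> (nat \<Rightarrow> real) set" where
  "real_space d = {x. \<forall>i. i \<notin> {1..d} \<longrightarrow> x i = 0}"

definition int_lattice :: "nat \<Rightarrow> (nat \<Rightarrow> real) set" where
  "int_lattice d = {x \<in> real_space d. \<forall>i\<in>{1..d}. x i \<in> \<int>}"

definition delta :: "nat \<Rightarrow> real" where
  "delta i = (if odd i then 0 else 1)"

definition polytope_P :: "nat \<Rightarrow> nat \<Rightarrow> (nat \<Rightarrow> real) set" where
  "polytope_P s d = {x \<in> real_space d. (\<forall>i\<in>{1..d}. 0 \<le> x i) \<and>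
      (\<forall>i\<in>{1..d - 1}. x i + x (i + 1) \<le> real s + delta i)}"

definition dilate :: "nat \<Rightarrow> (nat \<Rightarrow> real) set \<Rightarrow> (nat \<Rightarrow> real) set" where
  "dilate m X = (\<lambda>x i. real m * x i) ` X"

text \<open>
  The counting function is only meaningful for d at least 2: there the polytope is bounded, so the
  set below is finite. For d = 1 there is no upper bound on the single coordinate and
  \<^const>\<open>card\<close> returns 0 whenever m is positive.
\<close>

definition L :: "nat \<Rightarrow> nat \<Rightarrow> nat \<Rightarrow> nat" where
  "L s d m = card (dilate m (polytope_P s d) \<inter> int_lattice d)"

text \<open>Used only for j at most s, where the natural-number subtraction is exact.\<close>

definition a :: "nat \<Rightarrow> nat \<Rightarrow> nat \<Rightarrow> nat" where
  "a s m j = ((s + 1 - j) * m + j + 1) choose (2 * j)"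

definition even_seq :: "nat \<Rightarrow> nat \<Rightarrow> nat \<Rightarrow> nat" where
  "even_seq s m r = L s (2 * r + 2) m"

text \<open>Meaningful for r at least 1, cf. the remark on \<^const>\<open>L\<close>.\<close>

definition odd_seq :: "nat \<Rightarrow> nat \<Rightarrow> nat \<Rightarrow> nat" where
  "odd_seq s m r = L s (2 * r + 1) m"

definition odd_seq_ext :: "nat \<Rightarrow> nat \<Rightarrow> nat \<Rightarrow> nat" where
  "odd_seq_ext s m r = (if r = 0 then (s + 1) * m + 1 else odd_seq s m r)"

end

theory Submission
  imports Defs
begin

text \<open>
  The recurrence is the linear relation between words that avoid a pattern and words made only of
  that pattern (the inclusion-exclusion principle of Carlitz, Scoville and Vaughan). Group the
  coordinates of an integer point of the dilated polytope into pairs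
  \<open>(x\<^sub>1, x\<^sub>2), (x\<^sub>3, x\<^sub>4), \<dots>\<close>. With \<open>S = s * m\<close>, the inequalities of odd index say that every pair lies in the
  triangle \<open>x + y \<le> S\<close>; those of even index say that consecutive pairs \<open>(x, y)\<close>, \<open>(x', y')\<close> are linked,
  meaning \<open>y + x' \<le> S + m\<close>. So lattice points are words over the triangle with all consecutive letters
  linked. In odd dimension there is one more coordinate at the end, and the number of its possible
  values is a weight of the last pair.

  Let \<open>W\<^sub>n\<close> be the weighted number of linked words of \<open>n\<close> pairs, and \<open>A\<^sub>j\<close> the number of words of \<open>j\<close>
  pairs in which no two consecutive pairs are linked. Let \<open>X\<^sub>j\<^sub>,\<^sub>k\<close> be the weighted number of words of
  \<open>j + k\<close> pairs whose first \<open>j\<close> pairs have no links and whose last \<open>k + 1\<close> pairs, starting with the \<open>j\<close>th,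
  are all linked. Looking at the junction of a concatenation gives
  \<open>A\<^sub>j * W\<^sub>k = X\<^sub>j\<^sub>,\<^sub>k + X\<^sub>j\<^sub>+\<^sub>1\<^sub>,\<^sub>k\<^sub>-\<^sub>1\<close>
  (\<open>sum_unlinked_times_sum_linked\<close>), and \<open>W\<^sub>n = X\<^sub>1\<^sub>,\<^sub>n\<^sub>-\<^sub>1\<close>, so the alternating sum of these products
  telescopes to \<open>W\<^sub>n\<close> up to one boundary term (\<open>sum_linked_expansion\<close>).

  It remains to count words without links. With \<open>u = S - y\<close> such a word is a chain
  \<open>x\<^sub>1 \<le> u\<^sub>1\<close>, \<open>u\<^sub>1 + m < x\<^sub>2 \<le> u\<^sub>2\<close>, \<open>\<dots>\<close> in \<open>[0, S]\<close>, so these words correspond to subsets with \<open>2 * j\<close> elements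
  of a set of size \<open>(s + 1 - j) * m + j + 1\<close>, and \<open>A\<^sub>j\<close> is the coefficient of the recurrence
  (\<open>sum_unlinked_count_pairs\<close>). There is no such word with \<open>s + 1\<close> pairs, since its jumps would not fit into
  \<open>[0, s * m]\<close>. Hence the recurrence ends after \<open>s\<close> terms and, once there are at least \<open>s + 1\<close> pairs, the
  boundary term vanishes whatever the weight at the end is. This treats both parities at once.
\<close>

section \<open>Words with linked and with unlinked consecutive letters\<close>

text \<open>
  A word over \<open>V\<close> with all consecutive letters in relation \<open>R\<close> gets the weight \<open>g\<close> of its last letter.
  The value at \<open>n\<close> and \<open>x\<close> is the total weight of such words with first letter \<open>x\<close> and \<open>n\<close> further
  letters. The recursion grows a word at its front, so that \<open>g\<close> can encode any condition at its end.
\<close>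

primrec linked_sum :: "'v set \<Rightarrow> ('v \<Rightarrow> 'v \<Rightarrow> bool) \<Rightarrow> ('v \<Rightarrow> int) \<Rightarrow> nat \<Rightarrow> 'v \<Rightarrow> int" where
  "linked_sum V R g 0 x = g x"
| "linked_sum V R g (Suc n) x = (\<Sum>y | y \<in> V \<and> R x y. linked_sum V R g n y)"

text \<open>
  Here no two consecutive letters are in relation \<open>R\<close>, and the words grow at their back: the value
  at \<open>n\<close> and \<open>y\<close> is the number of such words with \<open>n\<close> letters in front of the last letter \<open>y\<close>.
\<close>

primrec unlinked_count :: "'v set \<Rightarrow> ('v \<Rightarrow> 'v \<Rightarrow> bool) \<Rightarrow> nat \<Rightarrow> 'v \<Rightarrow> int" where
  "unlinked_count V R 0 y = 1"
| "unlinked_count V R (Suc n) y = (\<Sum>x | x \<in> V \<and> \<not> R x y. unlinked_count V R n x)"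

text \<open>
  Concatenate a word without links and a word in which all consecutive letters are linked. If the
  two letters at the junction are linked, the last letter \<open>x\<close> of the first word also starts a linked
  word that is longer by one; otherwise the first letter \<open>y\<close> of the second word also ends a word
  without links that is longer by one.
\<close>

lemma sum_unlinked_times_sum_linked:
  assumes "finite V"
  shows "(\<Sum>x\<in>V. unlinked_count V R j x) * (\<Sum>y\<in>V. linked_sum V R g k y) =
           (\<Sum>x\<in>V. unlinked_count V R j x * linked_sum V R g (Suc k) x) +
           (\<Sum>y\<in>V. unlinked_count V R (Suc j) y * linked_sum V R g k y)"
proof -
  let ?p = "\<lambda>x y. unlinked_count V R j x * linked_sum V R g k y"
  have "(\<Sum>x\<in>V. unlinked_count V R j x) * (\<Sum>y\<in>V. linked_sum V R g k y) = (\<Sum>x\<in>V. \<Sum>y\<in>V. ?p x y)"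
    by (rule sum_product)
  also have "\<dots> = (\<Sum>x\<in>V. \<Sum>y\<in>V. (if R x y then ?p x y else 0) + (if \<not> R x y then ?p x y else 0))"
    by (intro sum.cong) auto
  also have "\<dots> = (\<Sum>x\<in>V. \<Sum>y\<in>V. if R x y then ?p x y else 0) +
                  (\<Sum>y\<in>V. \<Sum>x\<in>V. if \<not> R x y then ?p x y else 0)"
    unfolding sum.distrib by (subst (2) sum.swap) (rule refl)
  also have "\<dots> = (\<Sum>x\<in>V. \<Sum>y | y \<in> V \<and> R x y. ?p x y) +
                  (\<Sum>y\<in>V. \<Sum>x | x \<in> V \<and> \<not> R x y. ?p x y)"
    by (simp only: sum.inter_filter[OF assms])
  finally show ?thesis
    by (simp add: sum_distrib_left sum_distrib_right)
qed

text \<open>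
  The junction sums of the preceding lemma telescope with alternating signs. For \<open>k = 0\<close> the last
  sum is the left-hand side itself; raising \<open>k\<close> moves the junction one letter to the right.
\<close>

lemma sum_linked_expansion:
  assumes "finite V" and "k \<le> n"
  shows "(\<Sum>x\<in>V. linked_sum V R g n x) =
           (\<Sum>j<k. (-1) ^ j * (\<Sum>x\<in>V. unlinked_count V R j x) * (\<Sum>x\<in>V. linked_sum V R g (n - Suc j) x)) +
           (-1) ^ k * (\<Sum>x\<in>V. unlinked_count V R k x * linked_sum V R g (n - k) x)"
  using assms(2)
proof (induction k)
  case 0
  show ?case by simp
next
  case (Suc k)
  \<comment> \<open>The second factor of the junction sum at \<open>k\<close> is a recursion step away from the one at \<open>Suc k\<close>.\<close>
  then have n: "n - k = Suc (n - Suc k)" by simp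
  show ?case
    using Suc sum_unlinked_times_sum_linked[OF assms(1), of R k g "n - Suc k"]
    unfolding n by (simp add: algebra_simps del: linked_sum.simps unlinked_count.simps)
qed

section \<open>Counting words of pairs without links\<close>

definition pairs :: "nat \<Rightarrow> (nat \<times> nat) set" where
  "pairs S = {(x, y). x + y \<le> S}"

definition linked :: "nat \<Rightarrow> nat \<times> nat \<Rightarrow> nat \<times> nat \<Rightarrow> bool" where
  "linked T p q \<longleftrightarrow> snd p + fst q \<le> T"

lemma finite_pairs: "finite (pairs S)"
  by (rule finite_subset[of _ "{..S} \<times> {..S}"]) (auto simp: pairs_def)

text \<open>
  The hockey-stick identity, in a form that tolerates the truncated subtraction: whenever
  \<open>x + k < k * m\<close>, the upper index is \<open>0\<close> while the lower index is positive, so these terms vanish.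
\<close>

lemma inner_hockey_stick:
  "(\<Sum>x\<le>u. (x + k - k * m) choose (2 * k)) = (u + 1 + k - k * m) choose (2 * k + 1)"
proof (induction u)
  case 0
  show ?case
  proof (cases "k = 0")
    case False
    then have "k - k * m < 2 * k" "0 + 1 + k - k * m < 2 * k + 1" by linarith+
    then show ?thesis by (simp only: atMost_0 sum.insert sum.empty finite.emptyI empty_iff
      not_False_eq_True add_0 add_0_right binomial_eq_0)
  qed simp
next
  case (Suc u)
  show ?case
  proof (cases "k * m \<le> Suc u + k")
    case True
    then have "Suc u + 1 + k - k * m = Suc (Suc u + k - k * m)" by simp
    with Suc show ?thesis by simp
  next
    case False
    then have "k > 0" by (cases k) auto
    with False Suc show ?thesis by simp
  qed
qed

lemma outer_hockey_stick:
  "(\<Sum>u<t. (u + 1 + k - k * m) choose (2 * k + 1)) = (t + 1 + k - k * m) choose (2 * k + 2)"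
proof (induction t)
  case 0
  have "1 + k - k * m < 2 * k + 2" by linarith
  then show ?case by (simp add: binomial_eq_0)
next
  case (Suc t)
  show ?case
  proof (cases "k * m \<le> t + 1 + k")
    case True
    then have "Suc t + 1 + k - k * m = Suc (t + 1 + k - k * m)" by simp
    with Suc show ?thesis by simp
  next
    case False
    with Suc show ?thesis by simp
  qed
qed

text \<open>
  The substitution \<open>u = S - y\<close> turns \<open>x + y \<le> S\<close> into \<open>x \<le> u\<close> and the lower bound on \<open>y\<close> into an upper
  bound on \<open>u\<close>, so that the two hockey-stick sums can be applied one after the other.
\<close>

lemma sum_triangle:
  fixes h :: "nat \<Rightarrow> nat"
  assumes "t \<le> Suc S"
  shows "(\<Sum>p | p \<in> pairs S \<and> S < t + snd p. h (fst p)) = (\<Sum>u<t. \<Sum>x\<le>u. h x)"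
proof -
  have "(\<Sum>p | p \<in> pairs S \<and> S < t + snd p. h (fst p)) =
        (\<Sum>(u, x)\<in>(SIGMA u:{..<t}. {..u}). h x)"
    by (rule sum.reindex_bij_witness[of _ "\<lambda>(u, x). (x, S - u)" "\<lambda>(x, y). (S - y, x)"])
       (use assms in \<open>auto simp: pairs_def\<close>)
  then show ?thesis by (simp add: sum.Sigma)
qed

text \<open>
  Writing \<open>u\<^sub>i = S - y\<^sub>i\<close>, a word without links satisfies \<open>x\<^sub>i \<le> u\<^sub>i\<close> and \<open>u\<^sub>i + m < x\<^sub>i\<^sub>+\<^sub>1\<close>. After removing
  the forced gaps of size \<open>m\<close> and making the weak inequalities strict, the \<open>2 * k\<close> coordinates in front
  of the last pair form an arbitrary subset of an interval of length \<open>fst p + k - k * m\<close>.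
\<close>

lemma unlinked_count_pairs:
  assumes "p \<in> pairs S"
  shows "unlinked_count (pairs S) (linked (S + m)) k p = int ((fst p + k - k * m) choose (2 * k))"
  using assms
proof (induction k arbitrary: p)
  case 0
  show ?case by simp
next
  case (Suc k)
  have x: "fst p \<le> S" using Suc.prems by (auto simp: pairs_def)
  \<comment> \<open>If \<open>fst p < m\<close> the right-hand side is false by truncation, and every pair is linked to \<open>p\<close>.\<close>
  have conflict: "\<not> linked (S + m) q p \<longleftrightarrow> S < (fst p - m) + snd q" if "q \<in> pairs S" for q
    using that by (auto simp: linked_def pairs_def)
  have "unlinked_count (pairs S) (linked (S + m)) (Suc k) p =
          int (\<Sum>q | q \<in> pairs S \<and> S < (fst p - m) + snd q. (fst q + k - k * m) choose (2 * k))"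
    unfolding unlinked_count.simps of_nat_sum
    by (intro sum.cong) (simp_all only: conflict Suc.IH mem_Collect_eq cong: conj_cong)
  also have "\<dots> = int ((fst p - m + 1 + k - k * m) choose (2 * k + 2))"
    by (subst sum_triangle) (use x in \<open>auto simp only: inner_hockey_stick outer_hockey_stick\<close>)
  also have "(fst p - m + 1 + k - k * m) choose (2 * k + 2) =
             (fst p + Suc k - Suc k * m) choose (2 * Suc k)"
  proof (cases "m \<le> fst p")
    case True
    then have "fst p - m + 1 + k - k * m = fst p + Suc k - Suc k * m" by simp
    then show ?thesis by simp
  next
    case False
    then have "fst p - m + 1 + k - k * m < 2 * k + 2" "fst p + Suc k - Suc k * m < 2 * Suc k"
      by auto
    then show ?thesis by (simp only: binomial_eq_0)
  qed
  finally show ?case .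
qed

text \<open>
  The sum over the last pair has the same shape as one more step of the recursion, with the whole
  triangle \<open>u \<le> S\<close> in place of \<open>u < x - m\<close>.
\<close>

lemma sum_unlinked_count_pairs:
  "(\<Sum>p\<in>pairs S. unlinked_count (pairs S) (linked (S + m)) k p) =
     int ((S + 2 + k - k * m) choose (2 * k + 2))"
proof -
  have "(\<Sum>p\<in>pairs S. unlinked_count (pairs S) (linked (S + m)) k p) =
        int (\<Sum>p | p \<in> pairs S \<and> S < Suc S + snd p. (fst p + k - k * m) choose (2 * k))"
    unfolding of_nat_sum by (intro sum.cong) (auto simp: unlinked_count_pairs)
  also have "\<dots> = int ((Suc S + 1 + k - k * m) choose (2 * k + 2))"
    by (subst sum_triangle) (simp_all only: inner_hockey_stick outer_hockey_stick order_refl)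
  finally show ?thesis by simp
qed

text \<open>
  A word of \<open>s + 1\<close> pairs without links needs \<open>s\<close> jumps of at least \<open>m + 1\<close> inside \<open>[0, s * m]\<close>. This is
  why the recurrence stops after \<open>s\<close> terms.
\<close>

lemma unlinked_count_pairs_vanish:
  assumes "s \<ge> 1" and "p \<in> pairs (s * m)"
  shows "unlinked_count (pairs (s * m)) (linked (s * m + m)) s p = 0"
proof -
  have "fst p \<le> s * m" using assms(2) by (auto simp: pairs_def)
  then have "fst p + s - s * m < 2 * s" using assms(1) by linarith
  then show ?thesis by (simp add: unlinked_count_pairs[OF assms(2)] binomial_eq_0)
qed

lemma linked_sum_pairs_recurrence:
  fixes s m :: nat and g :: "nat \<times> nat \<Rightarrow> int"
  defines "W \<equiv> (\<lambda>n. \<Sum>p\<in>pairs (s * m). linked_sum (pairs (s * m)) (linked (s * m + m)) g n p)"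
  assumes "s \<ge> 1" and "n \<ge> s"
  shows "W n = (\<Sum>j=1..s. (-1) ^ (j + 1) * int (a s m j) * W (n - j))"
proof -
  let ?V = "pairs (s * m)" and ?R = "linked (s * m + m)"
  have "W n = (\<Sum>j<s. (-1) ^ j * (\<Sum>p\<in>?V. unlinked_count ?V ?R j p) * W (n - Suc j)) +
              (-1) ^ s * (\<Sum>p\<in>?V. unlinked_count ?V ?R s p * linked_sum ?V ?R g (n - s) p)"
    unfolding W_def by (rule sum_linked_expansion[OF finite_pairs \<open>n \<ge> s\<close>])
  also have "(\<Sum>p\<in>?V. unlinked_count ?V ?R s p * linked_sum ?V ?R g (n - s) p) = 0"
    using unlinked_count_pairs_vanish[OF \<open>s \<ge> 1\<close>] by simp
  also have "(\<Sum>j<s. (-1) ^ j * (\<Sum>p\<in>?V. unlinked_count ?V ?R j p) * W (n - Suc j)) =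
             (\<Sum>j<s. (-1) ^ j * int (a s m (Suc j)) * W (n - Suc j))"
  proof (intro sum.cong refl)
    fix j assume "j \<in> {..<s}"
    then have "j * m \<le> s * m" by (intro mult_le_mono1) simp
    moreover have "(s + 1 - Suc j) * m = s * m - j * m" by (simp add: diff_mult_distrib)
    ultimately have "s * m + 2 + j - j * m = (s + 1 - Suc j) * m + Suc j + 1" by linarith
    then show "(-1) ^ j * (\<Sum>p\<in>?V. unlinked_count ?V ?R j p) * W (n - Suc j) =
               (-1) ^ j * int (a s m (Suc j)) * W (n - Suc j)"
      by (simp add: sum_unlinked_count_pairs a_def)
  qed
  also have "\<dots> = (\<Sum>j=1..s. (-1) ^ (j + 1) * int (a s m j) * W (n - j))"
    by (rule sum.reindex_bij_witness[of _ "\<lambda>j. j - 1" Suc]) auto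
  finally show ?thesis by simp
qed

section \<open>Lattice points as words of pairs\<close>

text \<open>
  Integer points supported on \<open>{i..d}\<close> with first coordinate \<open>x\<close>. Keeping the right end \<open>d\<close> fixed and
  letting the left end \<open>i\<close> move allows coordinates to be removed without reindexing the others.
\<close>

definition tails :: "(nat \<Rightarrow> nat) \<Rightarrow> nat \<Rightarrow> nat \<Rightarrow> nat \<Rightarrow> (nat \<Rightarrow> nat) set" where
  "tails b d i x = {f. (\<forall>k. k \<notin> {i..d} \<longrightarrow> f k = 0) \<and> f i = x \<and>
     (\<forall>k\<in>{i..<d}. f k + f (k + 1) \<le> b k)}"

lemma tails_end: "tails b d d x = {(\<lambda>k. 0)(d := x)}"
  by (auto simp: tails_def fun_eq_iff)

lemma tails_decompose:
  assumes "i < d"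
  shows "tails b d i x = (\<Union>y\<in>{y. x + y \<le> b i}. (\<lambda>f. f(i := x)) ` tails b d (Suc i) y)"
proof (intro equalityI subsetI)
  fix f assume f: "f \<in> tails b d i x"
  have "f(i := 0) \<in> tails b d (Suc i) (f (Suc i))"
    using f by (auto simp: tails_def)
  moreover have "f = (f(i := 0))(i := x)" using f by (auto simp: tails_def)
  moreover have "x + f (Suc i) \<le> b i" using f assms by (auto simp: tails_def)
  ultimately show "f \<in> (\<Union>y\<in>{y. x + y \<le> b i}. (\<lambda>f. f(i := x)) ` tails b d (Suc i) y)" by blast
next
  fix f assume "f \<in> (\<Union>y\<in>{y. x + y \<le> b i}. (\<lambda>f. f(i := x)) ` tails b d (Suc i) y)"
  then obtain y h where "x + y \<le> b i" "h \<in> tails b d (Suc i) y" "f = h(i := x)" by blast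
  then show "f \<in> tails b d i x"
    using assms by (auto simp: tails_def)
qed

lemma finite_sum_le: "finite {y::nat. x + y \<le> c}"
  by (rule finite_subset[of _ "{..c}"]) auto

lemma finite_tails: "i \<le> d \<Longrightarrow> finite (tails b d i x)"
proof (induction i arbitrary: x rule: inc_induct)
  case base
  show ?case by (simp add: tails_end)
next
  case (step i)
  then show ?case by (simp add: tails_decompose finite_sum_le)
qed

lemma card_tails_step:
  assumes "i < d"
  shows "card (tails b d i x) = (\<Sum>y | x + y \<le> b i. card (tails b d (Suc i) y))"
proof -
  have inj: "inj_on (\<lambda>f. f(i := x)) (tails b d (Suc i) y)" for y
  proof (rule inj_onI)
    fix f h assume fh: "f \<in> tails b d (Suc i) y" "h \<in> tails b d (Suc i) y" "f(i := x) = h(i := x)"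
    have "f = (f(i := x))(i := 0)" using fh(1) by (auto simp: tails_def)
    also have "\<dots> = (h(i := x))(i := 0)" using fh(3) by simp
    also have "\<dots> = h" using fh(2) by (auto simp: tails_def)
    finally show "f = h" .
  qed
  have "card (tails b d i x) =
        (\<Sum>y | x + y \<le> b i. card ((\<lambda>f. f(i := x)) ` tails b d (Suc i) y))"
    unfolding tails_decompose[OF assms]
  proof (rule card_UN_disjoint)
    show "\<forall>y\<in>{y. x + y \<le> b i}. \<forall>z\<in>{y. x + y \<le> b i}. y \<noteq> z \<longrightarrow>
        (\<lambda>f. f(i := x)) ` tails b d (Suc i) y \<inter> (\<lambda>f. f(i := x)) ` tails b d (Suc i) z = {}"
      by (auto simp: tails_def dest!: fun_cong[where x = "Suc i"])
  qed (use assms in \<open>auto simp: finite_sum_le finite_tails\<close>)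
  then show ?thesis by (simp add: card_image[OF inj])
qed

text \<open>
  The inequality with index \<open>0\<close> also receives a bound, the one for even indices. It lets a point be
  extended by a coordinate \<open>0\<close> in front.
\<close>

definition bound :: "nat \<Rightarrow> nat \<Rightarrow> nat \<Rightarrow> nat" where
  "bound s m i = (if odd i then s * m else s * m + m)"

text \<open>
  Peeling off two coordinates \<open>x\<close>, \<open>y\<close> at indices \<open>i + 1\<close>, \<open>i + 2\<close> with \<open>i\<close> even splits the two inequalities
  involved: the odd one says that \<open>(x, y)\<close> is a letter, the even one that it is linked to the
  preceding letter. The \<open>e\<close> coordinates beyond the last full pair are absorbed into the weight \<open>g\<close>.
\<close>

lemma card_tails_eq_linked_sum:
  assumes g: "\<forall>i p. even i \<longrightarrow> int (card (tails (bound s m) (i + e) i (snd p))) = g p"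
    and "even i"
  shows "int (card (tails (bound s m) (i + 2 * n + e) i (snd p))) =
         linked_sum (pairs (s * m)) (linked (s * m + m)) g n p"
  using \<open>even i\<close>
proof (induction n arbitrary: i p)
  case 0
  then show ?case by (simp add: g)
next
  case (Suc n)
  let ?d = "i + 2 * Suc n + e"
  let ?V = "pairs (s * m)" and ?R = "linked (s * m + m)"
  have "int (card (tails (bound s m) ?d i (snd p))) =
        (\<Sum>x | snd p + x \<le> s * m + m. \<Sum>y | x + y \<le> s * m.
           int (card (tails (bound s m) ?d (i + 2) y)))"
    using Suc.prems by (simp add: card_tails_step bound_def)
  also have "\<dots> = (\<Sum>x | snd p + x \<le> s * m + m. \<Sum>y | x + y \<le> s * m. linked_sum ?V ?R g n (x, y))"
    using Suc.IH[of "i + 2" "(x, y)" for x y] Suc.prems by (simp add: algebra_simps)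
  also have "\<dots> = (\<Sum>q\<in>(SIGMA x:{x. snd p + x \<le> s * m + m}. {y. x + y \<le> s * m}). linked_sum ?V ?R g n q)"
    by (subst sum.Sigma) (auto simp: finite_sum_le)
  also have "(SIGMA x:{x. snd p + x \<le> s * m + m}. {y. x + y \<le> s * m}) = {q. q \<in> ?V \<and> ?R p q}"
    by (auto simp: pairs_def linked_def)
  finally show ?case by simp
qed

text \<open>
  The additional inequality between coordinates \<open>0\<close> and \<open>1\<close> is harmless because \<open>d \<ge> 2\<close>: the inequality
  between coordinates \<open>1\<close> and \<open>2\<close> already keeps coordinate \<open>1\<close> at most \<open>s * m\<close>.
\<close>

lemma lattice_points_eq_tails:
  assumes "m \<ge> 1" and "d \<ge> 2"
  shows "dilate m (polytope_P s d) \<inter> int_lattice d =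
         (\<lambda>f i. real (f i)) ` tails (bound s m) d 0 0"
proof (intro equalityI subsetI)
  fix z assume z: "z \<in> dilate m (polytope_P s d) \<inter> int_lattice d"
  then obtain x where x: "x \<in> polytope_P s d" "z = (\<lambda>i. real m * x i)"
    by (auto simp: dilate_def)
  have zero: "z i = 0" if "i \<notin> {1..d}" for i
    using z that unfolding int_lattice_def real_space_def by blast
  have nonneg: "0 \<le> z i" for i
    using x zero[of i] unfolding polytope_P_def by (cases "i \<in> {1..d}") auto
  have int: "z i \<in> \<int>" for i
    using z zero[of i] unfolding int_lattice_def by (cases "i \<in> {1..d}") auto
  define f where "f i = nat \<lfloor>z i\<rfloor>" for i
  have f: "z i = real (f i)" for i
    using nonneg[of i] int[of i] by (auto simp: f_def elim!: Ints_cases)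
  have le: "f i + f (i + 1) \<le> bound s m i" if "i \<in> {1..d - 1}" for i
  proof -
    have "x i + x (i + 1) \<le> real s + delta i" using x(1) that unfolding polytope_P_def by blast
    then have "real m * (x i + x (i + 1)) \<le> real m * (real s + delta i)"
      by (intro mult_left_mono) auto
    then have "real (f i) + real (f (i + 1)) \<le> real (bound s m i)"
      using f[of i] f[of "i + 1"] x(2)
      by (simp add: delta_def bound_def algebra_simps split: if_splits)
    then show ?thesis by linarith
  qed
  have f0: "f i = 0" if "i \<notin> {1..d}" for i using zero[OF that] f[of i] by simp
  have "f i + f (i + 1) \<le> bound s m i" if "i < d" for i
  proof (cases "i = 0")
    case True
    have "f 1 + f (1 + 1) \<le> bound s m 1" by (rule le) (use assms in auto)
    then show ?thesis using True f0[of 0] by (simp add: bound_def)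
  next
    case False
    then show ?thesis using le[of i] that by auto
  qed
  then have "f \<in> tails (bound s m) d 0 0" using f0 by (auto simp: tails_def)
  moreover have "z = (\<lambda>i. real (f i))" using f by auto
  ultimately show "z \<in> (\<lambda>f i. real (f i)) ` tails (bound s m) d 0 0" by blast
next
  fix z :: "nat \<Rightarrow> real" assume "z \<in> (\<lambda>f i. real (f i)) ` tails (bound s m) d 0 0"
  then obtain f where f: "f \<in> tails (bound s m) d 0 0" "z = (\<lambda>i. real (f i))" by blast
  have f0: "f i = 0" if "i \<notin> {1..d}" for i
    using f(1) that by (cases "i = 0") (auto simp: tails_def)
  define x where "x i = real (f i) / real m" for i
  have "x i + x (i + 1) \<le> real s + delta i" if "i \<in> {1..d - 1}" for i
  proof -
    have "f i + f (i + 1) \<le> bound s m i" using f(1) that by (auto simp: tails_def)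
    then have "real (f i + f (i + 1)) \<le> real (bound s m i)" by (rule of_nat_mono)
    also have "\<dots> = real m * (real s + delta i)"
      by (simp add: bound_def delta_def algebra_simps)
    finally show ?thesis using assms(1)
      by (simp add: x_def field_simps)
  qed
  then have "x \<in> polytope_P s d"
    using f0 by (auto simp: polytope_P_def real_space_def x_def)
  moreover have "z = (\<lambda>i. real m * x i)" using assms(1) f(2) by (auto simp: x_def)
  ultimately have "z \<in> dilate m (polytope_P s d)" unfolding dilate_def by blast
  moreover have "z \<in> int_lattice d" using f0 f(2) by (auto simp: int_lattice_def real_space_def)
  ultimately show "z \<in> dilate m (polytope_P s d) \<inter> int_lattice d" by blast
qed

lemma L_eq_card_tails:
  assumes "m \<ge> 1" and "d \<ge> 2"
  shows "L s d m = card (tails (bound s m) d 0 0)"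
  unfolding L_def lattice_points_eq_tails[OF assms]
  by (rule card_image) (auto simp: inj_on_def fun_eq_iff)

text \<open>
  A letter \<open>(0, 0)\<close> in front is linked to every pair, so summing over all first letters amounts to
  starting at \<open>(0, 0)\<close> with one more step.
\<close>

lemma L_eq_sum_linked:
  assumes "m \<ge> 1"
    and g: "\<forall>i p. even i \<longrightarrow> int (card (tails (bound s m) (i + e) i (snd p))) = g p"
  shows "int (L s (2 * n + 2 + e) m) =
         (\<Sum>p\<in>pairs (s * m). linked_sum (pairs (s * m)) (linked (s * m + m)) g n p)"
proof -
  have "int (L s (2 * n + 2 + e) m) = linked_sum (pairs (s * m)) (linked (s * m + m)) g (Suc n) (0, 0)"
    using card_tails_eq_linked_sum[OF g, of 0 "Suc n" "(0, 0)"] assms(1)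
    by (simp add: L_eq_card_tails)
  moreover have "{p. p \<in> pairs (s * m) \<and> linked (s * m + m) (0, 0) p} = pairs (s * m)"
    by (auto simp: pairs_def linked_def)
  ultimately show ?thesis by simp
qed

section \<open>The recurrences\<close>

lemma L_recurrence:
  fixes g :: "nat \<times> nat \<Rightarrow> int"
  assumes "s \<ge> 1" and "m \<ge> 1" and "n \<ge> s"
    and g: "\<forall>i p. even i \<longrightarrow> int (card (tails (bound s m) (i + e) i (snd p))) = g p"
  shows "int (L s (2 * n + 2 + e) m) =
         (\<Sum>j=1..s. (-1) ^ (j + 1) * int (a s m j) * int (L s (2 * (n - j) + 2 + e) m))"
  unfolding L_eq_sum_linked[OF \<open>m \<ge> 1\<close> g] by (rule linked_sum_pairs_recurrence) fact+

theorem corollary3p6: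
  fixes s m :: nat
  assumes "s \<ge> 1" and "m \<ge> 1"
  shows "(\<forall>r\<ge>s. int (even_seq s m r) =
            (\<Sum>j=1..s. (-1) ^ (j + 1) * int (a s m j) * int (even_seq s m (r - j)))) \<and>
         (\<forall>r\<ge>s + 1. int (odd_seq s m r) =
            (\<Sum>j=1..s. (-1) ^ (j + 1) * int (a s m j) * int (odd_seq s m (r - j)))) \<and>
         (\<forall>r\<ge>s + 1. int (odd_seq_ext s m r) =
            (\<Sum>j=1..s. (-1) ^ (j + 1) * int (a s m j) * int (odd_seq_ext s m (r - j))))"
proof -
  have even: "int (even_seq s m r) =
      (\<Sum>j=1..s. (-1) ^ (j + 1) * int (a s m j) * int (even_seq s m (r - j)))" if "r \<ge> s" for r
    using L_recurrence[OF assms that, of 0 "\<lambda>_. 1"] by (simp add: even_seq_def tails_end)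
  have odd: "int (odd_seq s m r) =
      (\<Sum>j=1..s. (-1) ^ (j + 1) * int (a s m j) * int (odd_seq s m (r - j)))" if "r \<ge> s + 1" for r
  proof -
    \<comment> \<open>The unpaired last coordinate only has to respect the even inequality to its left. Since \<open>r\<close> pairs
      precede it, the word has \<open>r - 1\<close> pairs after its first one.\<close>
    have g: "\<forall>i p. even i \<longrightarrow> int (card (tails (bound s m) (i + 1) i (snd p))) =
        int (card {t. snd (p :: nat \<times> nat) + t \<le> s * m + m})"
      by (simp add: card_tails_step tails_end bound_def)
    have shift: "2 * (r - 1 - j) + 2 + 1 = 2 * (r - j) + 1" if "j \<le> s" for j
      using that \<open>r \<ge> s + 1\<close> by simp
    have "s \<le> r - 1" using that by simp
    note L_recurrence[OF assms this g]
    also have "(\<Sum>j=1..s. (-1) ^ (j + 1) * int (a s m j) * int (L s (2 * (r - 1 - j) + 2 + 1) m)) =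
        (\<Sum>j=1..s. (-1) ^ (j + 1) * int (a s m j) * int (odd_seq s m (r - j)))"
      by (intro sum.cong refl) (simp only: odd_seq_def shift atLeastAtMost_iff)
    finally show ?thesis using shift[of 0] by (simp add: odd_seq_def)
  qed
  \<comment> \<open>For \<open>r \<ge> s + 1\<close> no index \<open>r - j\<close> reaches \<open>0\<close>, so the extended sequence obeys the same recurrence.\<close>
  have ext: "odd_seq_ext s m r = odd_seq s m r" if "r \<ge> 1" for r
    using that by (simp add: odd_seq_ext_def)
  have "int (odd_seq_ext s m r) =
      (\<Sum>j=1..s. (-1) ^ (j + 1) * int (a s m j) * int (odd_seq_ext s m (r - j)))"
    if "r \<ge> s + 1" for r
  proof -
    have "odd_seq_ext s m (r - j) = odd_seq s m (r - j)" if "j \<in> {1..s}" for j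
      by (rule ext) (use that \<open>r \<ge> s + 1\<close> in auto)
    then show ?thesis using odd[OF that] ext[of r] that by simp
  qed
  with even odd show ?thesis by blast
qed

end
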